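(* If $n\equiv 0\pmod 4$, then $\mathcal{G}_n^*$ is connected.
   Context: $\mathcal{G}_n$ is the set of simple 3-regular graphs on vertex set $[n]$. A make move ${\tt make}(yxvwz)$ applies to $G=(V,E)$ when $y,x,v,w,z$ are distinct, $yx,xv,vw,wz\in E$ and $xw,yz\notin E$, and replaces $E$ by $(E\setminus\{xy,wz\})\cup\{xw,yz\}$. A break move ${\tt break}(vxw,yz)$ applies when $vxwv$ is a triangle, $yz\in E$, $\{y,z\}\cap\{v,x,w\}=\emptyset$ and $xy,wz\notin E$, and replaces $E$ by $(E\setminus\{xw,yz\})\cup\{xy,wz\}$. $\mathcal{G}_n^*$ is the graph on vertex set $\mathcal{G}_n$ with $G,G'$ adjacent iff a make or break move takes $G$ to $G'$. *)

theory Defs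
  imports "Graph_Theory.Graph_Theory" "HOL-Number_Theory.Cong"
begin

text \<open>
  All graphs here are simple and have the fixed vertex set \<open>{1..n}\<close>, so a graph is identified with
  its edge set, a set of two-element subsets of \<open>{1..n}\<close>; the edge \<open>xy\<close> is the set \<open>{x, y}\<close>.
\<close>

type_synonym edge_set = "nat set set"

definition simple_graphs :: "nat \<Rightarrow> edge_set set" where
  "simple_graphs n = Pow {e. e \<subseteq> {1..n} \<and> card e = 2}"

definition degree :: "edge_set \<Rightarrow> nat \<Rightarrow> nat" where
  "degree E v = card {e \<in> E. v \<in> e}"

definition cubic_graphs :: "nat \<Rightarrow> edge_set set" where
  "cubic_graphs n = {E \<in> simple_graphs n. \<forall>v \<in> {1..n}. degree E v = 3}"

definition make_move :: "nat \<Rightarrow> nat \<Rightarrow> nat \<Rightarrow> nat \<Rightarrow> nat \<Rightarrow> edge_set \<Rightarrow> edge_set \<Rightarrow> bool" where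
  "make_move y x v w z E E' \<longleftrightarrow>
     distinct [y, x, v, w, z] \<and>
     {y, x} \<in> E \<and> {x, v} \<in> E \<and> {v, w} \<in> E \<and> {w, z} \<in> E \<and>
     {x, w} \<notin> E \<and> {y, z} \<notin> E \<and>
     E' = (E - {{x, y}, {w, z}}) \<union> {{x, w}, {y, z}}"

definition break_move :: "nat \<Rightarrow> nat \<Rightarrow> nat \<Rightarrow> nat \<Rightarrow> nat \<Rightarrow> edge_set \<Rightarrow> edge_set \<Rightarrow> bool" where
  "break_move v x w y z E E' \<longleftrightarrow>
     distinct [v, x, w] \<and> {v, x} \<in> E \<and> {x, w} \<in> E \<and> {w, v} \<in> E \<and>
     {y, z} \<in> E \<and> {y, z} \<inter> {v, x, w} = {} \<and>
     {x, y} \<notin> E \<and> {w, z} \<notin> E \<and>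
     E' = (E - {{x, w}, {y, z}}) \<union> {{x, y}, {w, z}}"

definition triangle_move :: "edge_set \<Rightarrow> edge_set \<Rightarrow> bool" where
  "triangle_move E E' \<longleftrightarrow>
     (\<exists>y x v w z. make_move y x v w z E E') \<or> (\<exists>v x w y z. break_move v x w y z E E')"

text \<open>
  Every make move is undone by a break move and vice versa, so the arc relation below is symmetric
  and the digraph represents an undirected graph.
\<close>

definition move_graph :: "nat \<Rightarrow> edge_set pair_pre_digraph" where
  "move_graph n =
     \<lparr> pverts = cubic_graphs n,
       parcs = {(E, E') \<in> cubic_graphs n \<times> cubic_graphs n. triangle_move E E'} \<rparr>"

end

theory Submission
  imports Defs
begin

text \<open>
  A triangle is a catalyst: breaking it with an edge \<open>rs\<close> and remaking it elsewhere switches an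
  edge \<open>ap\<close> leaving the triangle with \<open>rs\<close>, while the triangle survives. Such switches first give
  two triangle vertices a second common neighbour and then turn the resulting diamond into a
  \<open>K\<^sub>4\<close>, so every cubic graph on at least eight vertices reaches one with a \<open>K\<^sub>4\<close> component. The
  rest of the graph is handled by induction on the number of vertices. In particular it may be
  assumed to contain a second \<open>K\<^sub>4\<close> through any given vertex, and exchanging vertices between the
  two, one at a time, moves the first component to any other vertex set.
\<close>

section \<open>Cubic graphs on an arbitrary vertex set\<close>

definition nb :: "edge_set \<Rightarrow> nat \<Rightarrow> nat set" where
  "nb E v = {u. {v, u} \<in> E}"

text \<open>The vertex set is a parameter because the induction on its size deletes four arbitrary
  vertices. Neighbourhoods replace degrees because a switch changes a neighbourhood by exchanging
  one element.\<close>

definition cubic_on :: "nat set \<Rightarrow> edge_set \<Rightarrow> bool" where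
  "cubic_on V E \<longleftrightarrow> (\<forall>e \<in> E. e \<subseteq> V \<and> card e = 2) \<and> (\<forall>v \<in> V. card (nb E v) = 3)"

text \<open>The common shape of both moves: \<open>make_move y x v w z\<close> performs
  \<open>switch x y w z\<close>, and \<open>break_move v x w y z\<close> performs
  \<open>switch x w y z\<close>.\<close>

definition switch :: "nat \<Rightarrow> nat \<Rightarrow> nat \<Rightarrow> nat \<Rightarrow> edge_set \<Rightarrow> edge_set" where
  "switch a p r s E = (E - {{a, p}, {r, s}}) \<union> {{a, r}, {p, s}}"

definition complete_on :: "nat set \<Rightarrow> edge_set" where
  "complete_on K = {e. e \<subseteq> K \<and> card e = 2}"

abbreviation reach :: "edge_set \<Rightarrow> edge_set \<Rightarrow> bool" where
  "reach \<equiv> triangle_move\<^sup>*\<^sup>*"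

text \<open>In a cubic graph such a \<open>K\<close> uses up all edges at its vertices and is
  therefore a whole component; see \<open>K4_split\<close>.\<close>

definition has_K4 :: "edge_set \<Rightarrow> bool" where
  "has_K4 E \<longleftrightarrow> (\<exists>K. card K = 4 \<and> complete_on K \<subseteq> E)"

definition reaches_K4 :: "edge_set \<Rightarrow> bool" where
  "reaches_K4 E \<longleftrightarrow> (\<exists>E'. reach E E' \<and> has_K4 E')"

lemma in_nb_iff: "u \<in> nb E v \<longleftrightarrow> {v, u} \<in> E"
  by (simp add: nb_def)

lemma edge_iff_nb:
  "{x, y} \<in> E \<longleftrightarrow> y \<in> nb E x"
  "{x, y} \<in> E \<longleftrightarrow> x \<in> nb E y"
  by (auto simp: nb_def insert_commute)

lemma degree_eq_card_nb:
  assumes "\<forall>e \<in> E. card e = 2"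
  shows "degree E v = card (nb E v)"
proof -
  have "{e \<in> E. v \<in> e} = (\<lambda>u. {v, u}) ` nb E v"
  proof
    show "{e \<in> E. v \<in> e} \<subseteq> (\<lambda>u. {v, u}) ` nb E v"
    proof
      fix e assume e: "e \<in> {e \<in> E. v \<in> e}"
      then have "card e = 2" using assms by blast
      then obtain x y where "e = {x, y}" by (auto simp: card_2_iff)
      with e show "e \<in> (\<lambda>u. {v, u}) ` nb E v"
        by (auto simp: nb_def insert_commute)
    qed
  qed (auto simp: nb_def)
  moreover have "inj_on (\<lambda>u. {v, u}) (nb E v)"
    by (auto simp: inj_on_def doubleton_eq_iff)
  ultimately show ?thesis
    by (simp add: degree_def card_image)
qed

lemma cubic_graphs_iff: "E \<in> cubic_graphs n \<longleftrightarrow> cubic_on {1..n} E"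
proof -
  have "(\<forall>v\<in>{1..n}. degree E v = 3) \<longleftrightarrow> (\<forall>v\<in>{1..n}. card (nb E v) = 3)"
    if "\<forall>e \<in> E. card e = 2"
    by (simp add: degree_eq_card_nb[OF that])
  then show ?thesis
    unfolding cubic_graphs_def simple_graphs_def cubic_on_def by auto
qed

lemma cubic_on_edgeD:
  assumes "cubic_on V E" "{x, y} \<in> E"
  shows "x \<noteq> y" "x \<in> V" "y \<in> V"
  using assms by (auto simp: cubic_on_def)

text \<open>Three known neighbours leave no room for a fourth. Many of the non-edges that moves
  require are derived from this.\<close>

lemma nb_eqI:
  assumes "cubic_on V E" "{v, x} \<in> E" "{v, y} \<in> E" "{v, z} \<in> E" "distinct [x, y, z]"
  shows "nb E v = {x, y, z}"
proof -
  have "card (nb E v) = 3"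
    using assms by (auto simp: cubic_on_def)
  moreover from this have "finite (nb E v)"
    by (intro card_ge_0_finite) simp
  moreover have "{x, y, z} \<subseteq> nb E v"
    using assms by (auto simp: nb_def)
  ultimately show ?thesis
    using assms(5) by (intro card_subset_eq[symmetric]) auto
qed

lemma nb_obtain:
  assumes "cubic_on V E" "v \<in> V"
  obtains x y z where "distinct [x, y, z]" "nb E v = {x, y, z}"
proof -
  have "card (nb E v) = 3"
    using assms by (auto simp: cubic_on_def)
  then show thesis
    using that by (auto simp: card_3_iff)
qed

lemma nb_obtain1:
  assumes "cubic_on V E" "{v, x} \<in> E"
  obtains y z where "distinct [v, x, y, z]" "nb E v = {x, y, z}"
proof -
  obtain x' y' z' where d: "distinct [x', y', z']" and n: "nb E v = {x', y', z'}"
    using nb_obtain[OF assms(1)] cubic_on_edgeD[OF assms] by metis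
  have "v \<notin> nb E v"
    using cubic_on_edgeD(1)[OF assms(1)] by (simp only: nb_def) blast
  have "x \<in> {x', y', z'}"
    using assms(2) n by (auto simp: nb_def)
  then consider "x = x'" | "x = y'" | "x = z'" by blast
  then show thesis
  proof cases
    case 1 with d n \<open>v \<notin> nb E v\<close> show ?thesis by (intro that[of y' z']) auto
  next
    case 2 with d n \<open>v \<notin> nb E v\<close> show ?thesis by (intro that[of x' z']) auto
  next
    case 3 with d n \<open>v \<notin> nb E v\<close> show ?thesis by (intro that[of x' y']) auto
  qed
qed

lemma nb_obtain2:
  assumes "cubic_on V E" "{v, x} \<in> E" "{v, y} \<in> E" "x \<noteq> y"
  obtains z where "distinct [v, x, y, z]" "nb E v = {x, y, z}"
proof -
  obtain y' z' where d: "distinct [v, x, y', z']" and n: "nb E v = {x, y', z'}"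
    using nb_obtain1[OF assms(1,2)] .
  have "y \<in> {x, y', z'}"
    using assms(3) n by (auto simp: nb_def)
  then consider "y = y'" | "y = z'" using assms(4) by blast
  then show thesis
  proof cases
    case 1 with d n show ?thesis by (intro that[of z']) auto
  next
    case 2 with d n show ?thesis by (intro that[of y']) auto
  qed
qed

section \<open>Invariance of cubicity\<close>

text \<open>Each of the four vertices loses one neighbour and gains one, and the gained one is new
  because \<open>ar\<close> and \<open>ps\<close> are non-edges.\<close>

lemma cubic_on_switch:
  assumes E: "cubic_on V E" and e: "{a, p} \<in> E" "{r, s} \<in> E" "{a, r} \<notin> E" "{p, s} \<notin> E"
    and d: "distinct [a, p, r, s]"
  shows "cubic_on V (switch a p r s E)"
proof -
  have V: "a \<in> V" "p \<in> V" "r \<in> V" "s \<in> V"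
    using cubic_on_edgeD[OF E] e by blast+
  have "card (nb (switch a p r s E) v) = 3" if v: "v \<in> V" for v
  proof -
    have c: "card (nb E v) = 3"
      using E v by (auto simp: cubic_on_def)
    then have f: "finite (nb E v)"
      by (intro card_ge_0_finite) simp
    have *: "card (insert y (nb E v - {x})) = 3" if "x \<in> nb E v" "y \<notin> nb E v" for x y
      using that c f by (simp add: card_Diff_singleton)
    have "nb (switch a p r s E) v =
      (if v = a then insert r (nb E v - {p}) else if v = p then insert s (nb E v - {a})
       else if v = r then insert a (nb E v - {s}) else if v = s then insert p (nb E v - {r})
       else nb E v)"
      using d e by (auto simp: nb_def switch_def doubleton_eq_iff insert_commute)
    moreover have "card (insert r (nb E v - {p})) = 3" if "v = a"
      using that e by (intro *) (auto simp: in_nb_iff insert_commute)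
    moreover have "card (insert s (nb E v - {a})) = 3" if "v = p"
      using that e by (intro *) (auto simp: in_nb_iff insert_commute)
    moreover have "card (insert a (nb E v - {s})) = 3" if "v = r"
      using that e by (intro *) (auto simp: in_nb_iff insert_commute)
    moreover have "card (insert p (nb E v - {r})) = 3" if "v = s"
      using that e by (intro *) (auto simp: in_nb_iff insert_commute)
    ultimately show ?thesis
      using c by simp
  qed
  moreover have "\<forall>e \<in> switch a p r s E. e \<subseteq> V \<and> card e = 2"
    using E V d by (auto simp: switch_def cubic_on_def)
  ultimately show ?thesis
    by (simp add: cubic_on_def)
qed

lemma cubic_on_triangle_move:
  assumes E: "cubic_on V E" and "triangle_move E E'"
  shows "cubic_on V E'"
  using assms(2) unfolding triangle_move_def
proof (elim disjE exE)
  fix y x v w z assume m: "make_move y x v w z E E'"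
  then have "E' = switch x y w z E"
    by (simp add: make_move_def switch_def)
  moreover have "cubic_on V (switch x y w z E)"
    using m by (intro cubic_on_switch[OF E]) (auto simp: make_move_def insert_commute)
  ultimately show ?thesis
    by simp
next
  fix v x w y z assume m: "break_move v x w y z E E'"
  then have eq: "E' = switch x w y z E"
    by (simp add: break_move_def switch_def)
  \<comment> \<open>\<open>break_move\<close> leaves \<open>y = z\<close> open; it is excluded
    because every edge of a cubic graph has two elements.\<close>
  have "y \<noteq> z"
    using m cubic_on_edgeD[OF E] by (auto simp: break_move_def)
  have "cubic_on V (switch x w y z E)"
    using m \<open>y \<noteq> z\<close> by (intro cubic_on_switch[OF E]) (auto simp: break_move_def insert_commute)
  with eq show ?thesis
    by simp
qed

lemma cubic_on_reach:
  assumes "reach E E'" "cubic_on V E"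
  shows "cubic_on V E'"
  using assms by (induction rule: rtranclp_induct) (auto intro: cubic_on_triangle_move)

section \<open>Reversibility of moves\<close>

lemma exchange_reverse:
  assumes "E' = (E - {A, B}) \<union> {C, D}" "A \<in> E" "B \<in> E" "C \<notin> E" "D \<notin> E"
  shows "E = (E' - {C, D}) \<union> {A, B}"
  using assms by blast

text \<open>The new edge \<open>xw\<close> closes the path \<open>x v w\<close> to a triangle, and
  breaking it with the new edge \<open>yz\<close> restores \<open>xy\<close> and
  \<open>wz\<close>.\<close>

lemma make_reverse:
  assumes "make_move y x v w z E E'"
  shows "break_move v x w y z E' E"
proof -
  have m: "distinct [y, x, v, w, z]" "{x, y} \<in> E" "{x, v} \<in> E" "{v, w} \<in> E" "{w, z} \<in> E"
    "{x, w} \<notin> E" "{y, z} \<notin> E" and E': "E' = (E - {{x, y}, {w, z}}) \<union> {{x, w}, {y, z}}"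
    using assms by (simp_all add: make_move_def insert_commute)
  have "E = (E' - {{x, w}, {y, z}}) \<union> {{x, y}, {w, z}}"
    using E' m(2,5,6,7) by (rule exchange_reverse)
  moreover have "{v, x} \<in> E'" "{x, w} \<in> E'" "{w, v} \<in> E'" "{y, z} \<in> E'" "{x, y} \<notin> E'" "{w, z} \<notin> E'"
    unfolding E' using m by (auto simp: doubleton_eq_iff insert_commute)
  ultimately show ?thesis
    unfolding break_move_def using m(1) by (intro conjI) auto
qed

lemma break_reverse:
  assumes "break_move v x w y z E E'" "y \<noteq> z"
  shows "make_move y x v w z E' E"
proof -
  have m: "distinct [y, x, v, w, z]" "{x, w} \<in> E" "{y, z} \<in> E" "{x, v} \<in> E" "{v, w} \<in> E"
    "{x, y} \<notin> E" "{w, z} \<notin> E" and E': "E' = (E - {{x, w}, {y, z}}) \<union> {{x, y}, {w, z}}"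
    using assms by (auto simp: break_move_def insert_commute)
  have "E = (E' - {{x, y}, {w, z}}) \<union> {{x, w}, {y, z}}"
    using E' m(2,3,6,7) by (rule exchange_reverse)
  moreover have "{y, x} \<in> E'" "{x, v} \<in> E'" "{v, w} \<in> E'" "{w, z} \<in> E'" "{x, w} \<notin> E'" "{y, z} \<notin> E'"
    unfolding E' using m by (auto simp: doubleton_eq_iff insert_commute)
  ultimately show ?thesis
    unfolding make_move_def using m(1) by (intro conjI) auto
qed

lemma triangle_move_sym:
  assumes E: "cubic_on V E" and "triangle_move E E'"
  shows "triangle_move E' E"
  using assms(2) unfolding triangle_move_def
proof (elim disjE exE)
  fix v x w y z assume m: "break_move v x w y z E E'"
  then have "y \<noteq> z"
    using cubic_on_edgeD[OF E] by (auto simp: break_move_def)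
  then show "(\<exists>y x v w z. make_move y x v w z E' E) \<or> (\<exists>v x w y z. break_move v x w y z E' E)"
    using break_reverse m by blast
qed (use make_reverse in blast)

lemma reach_sym:
  assumes "reach E E'" "cubic_on V E"
  shows "reach E' E"
  using assms
proof (induction rule: rtranclp_induct)
  case (step F G)
  then have "triangle_move G F"
    by (meson cubic_on_reach triangle_move_sym)
  with step show ?case
    by (meson converse_rtranclp_into_rtranclp)
qed simp

section \<open>Moves next to a disjoint graph\<close>

lemma exchange_Un:
  assumes "E' = (E - {A, B}) \<union> {C, D}" "A \<notin> F" "B \<notin> F"
  shows "E' \<union> F = ((E \<union> F) - {A, B}) \<union> {C, D}"
  using assms by blast

text \<open>Every vertex of a move lies on an edge of \<open>E\<close>, hence in \<open>V\<close>,
  while the edges of \<open>F\<close> avoid \<open>V\<close>. So \<open>F\<close> contains neither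
  an edge that is removed nor one that has to be absent.\<close>

lemma triangle_move_Un:
  assumes E: "cubic_on V E" and "triangle_move E E'" and F: "\<forall>f \<in> F. f \<inter> V = {}"
  shows "triangle_move (E \<union> F) (E' \<union> F)"
proof -
  have new: "{x, y} \<notin> F" if "x \<in> V" for x y
  proof
    assume "{x, y} \<in> F"
    with F have "{x, y} \<inter> V = {}" by simp
    with that show False by simp
  qed
  show ?thesis
    using assms(2) unfolding triangle_move_def
  proof (elim disjE exE)
    fix y x v w z assume m: "make_move y x v w z E E'"
    then have V: "{y, x, v, w, z} \<subseteq> V"
      using cubic_on_edgeD[OF E] by (auto simp: make_move_def)
    have "E' \<union> F = ((E \<union> F) - {{x, y}, {w, z}}) \<union> {{x, w}, {y, z}}"
      using m V new unfolding make_move_def by (intro exchange_Un) simp_all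
    moreover have "{x, w} \<notin> E \<union> F" "{y, z} \<notin> E \<union> F"
      using m V new unfolding make_move_def by simp_all
    ultimately have "make_move y x v w z (E \<union> F) (E' \<union> F)"
      using m unfolding make_move_def
      by (elim conjE, intro conjI) (assumption | (rule UnI1, assumption))+
    then show "(\<exists>y x v w z. make_move y x v w z (E \<union> F) (E' \<union> F)) \<or>
        (\<exists>v x w y z. break_move v x w y z (E \<union> F) (E' \<union> F))" by blast
  next
    fix v x w y z assume m: "break_move v x w y z E E'"
    then have V: "{y, x, v, w, z} \<subseteq> V"
      using cubic_on_edgeD[OF E] by (auto simp: break_move_def)
    have "E' \<union> F = ((E \<union> F) - {{x, w}, {y, z}}) \<union> {{x, y}, {w, z}}"
      using m V new unfolding break_move_def by (intro exchange_Un) simp_all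
    moreover have "{x, y} \<notin> E \<union> F" "{w, z} \<notin> E \<union> F"
      using m V new unfolding break_move_def by simp_all
    ultimately have "break_move v x w y z (E \<union> F) (E' \<union> F)"
      using m unfolding break_move_def
      by (elim conjE, intro conjI) (assumption | (rule UnI1, assumption))+
    then show "(\<exists>y x v w z. make_move y x v w z (E \<union> F) (E' \<union> F)) \<or>
        (\<exists>v x w y z. break_move v x w y z (E \<union> F) (E' \<union> F))" by blast
  qed
qed

lemma reach_Un:
  assumes "reach E E'" "cubic_on V E" "\<forall>f \<in> F. f \<inter> V = {}"
  shows "reach (E \<union> F) (E' \<union> F)"
  using assms
proof (induction rule: rtranclp_induct)
  case (step G H)
  then have "triangle_move (G \<union> F) (H \<union> F)"
    by (meson cubic_on_reach triangle_move_Un)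
  with step show ?case
    by (meson rtranclp.rtrancl_into_rtrancl)
qed simp

section \<open>Switching at a triangle\<close>

text \<open>The edge count of \<open>reach_switch\<close>, with \<open>X = ap\<close>,
  \<open>U = ab\<close>, \<open>W = rs\<close>, \<open>Y = ar\<close>, \<open>Z = bs\<close>,
  \<open>D = ps\<close>: over the two moves \<open>ab\<close> is removed and restored,
  \<open>bs\<close> is added and removed.\<close>

lemma exchange_exchange:
  assumes "X \<noteq> U" "X \<noteq> Y" "X \<noteq> Z" "Z \<noteq> Y" "W \<noteq> U" "Z \<notin> E" "U \<in> E"
  shows "(E - {X, W}) \<union> {Y, D} = ((E - {U, W} \<union> {Y, Z}) - {X, Z}) \<union> {U, D}"
  using assms by blast

text \<open>
  The edge \<open>ap\<close> leaving a triangle \<open>abc\<close> is switched with \<open>rs\<close> by first breaking the triangle with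
  \<open>ab, rs\<close> and then remaking it along the path \<open>pacbs\<close>.
\<close>
lemma reach_switch:
  assumes "{a, b} \<in> E" "{b, c} \<in> E" "{a, c} \<in> E" "{a, p} \<in> E" "{r, s} \<in> E"
    and "{a, r} \<notin> E" "{b, s} \<notin> E" "{p, s} \<notin> E"
    and "distinct [a, b, c, p, s]" "distinct [a, b, c, r, s]" "p \<noteq> r"
  shows "reach E (switch a p r s E)"
proof -
  let ?F = "(E - {{a, b}, {r, s}}) \<union> {{a, r}, {b, s}}"
  have "break_move c a b r s E ?F"
    using assms by (auto simp: break_move_def insert_commute)
  moreover have "make_move p a c b s ?F (switch a p r s E)"
    unfolding make_move_def
  proof (intro conjI)
    show "switch a p r s E = (?F - {{a, p}, {b, s}}) \<union> {{a, b}, {p, s}}"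
    proof -
      have "{a, p} \<noteq> {a, b}" "{a, p} \<noteq> {a, r}" "{a, p} \<noteq> {b, s}" "{b, s} \<noteq> {a, r}" "{r, s} \<noteq> {a, b}"
        using assms by (auto simp: doubleton_eq_iff)
      moreover have "{b, s} \<notin> E" "{a, b} \<in> E"
        using assms by simp_all
      ultimately show ?thesis
        unfolding switch_def by (intro exchange_exchange)
    qed
  qed (use assms in \<open>auto simp: doubleton_eq_iff insert_commute\<close>)
  ultimately have "triangle_move E ?F" "triangle_move ?F (switch a p r s E)"
    unfolding triangle_move_def by blast+
  then show ?thesis
    by (meson converse_rtranclp_into_rtranclp r_into_rtranclp)
qed

section \<open>From a diamond to a K4\<close>

lemma complete_on_4:
  assumes "distinct [a, b, c, d]"
  shows "complete_on {a, b, c, d} = {{a, b}, {a, c}, {a, d}, {b, c}, {b, d}, {c, d}}"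
proof
  show "complete_on {a, b, c, d} \<subseteq> {{a, b}, {a, c}, {a, d}, {b, c}, {b, d}, {c, d}}"
  proof
    fix e assume e: "e \<in> complete_on {a, b, c, d}"
    then obtain x y where "e = {x, y}" "x \<noteq> y"
      by (auto simp: complete_on_def card_2_iff)
    with e have "x \<in> {a, b, c, d}" "y \<in> {a, b, c, d}"
      by (auto simp: complete_on_def)
    with \<open>x \<noteq> y\<close> show "e \<in> {{a, b}, {a, c}, {a, d}, {b, c}, {b, d}, {c, d}}"
      unfolding \<open>e = {x, y}\<close> by (elim insertE emptyE) (simp_all add: doubleton_eq_iff)
  qed
qed (use assms in \<open>auto simp: complete_on_def\<close>)

lemma has_K4I:
  assumes "distinct [a, b, c, d]"
    and "{a, b} \<in> E" "{a, c} \<in> E" "{a, d} \<in> E" "{b, c} \<in> E" "{b, d} \<in> E" "{c, d} \<in> E"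
  shows "has_K4 E"
  unfolding has_K4_def using assms
  by (intro exI[of _ "{a, b, c, d}"]) (simp add: complete_on_4)

lemma reaches_K4_trans:
  assumes "reach E E'" "reaches_K4 E'"
  shows "reaches_K4 E"
  using assms unfolding reaches_K4_def by (meson rtranclp_trans)

text \<open>The excluded vertices form a list, so that its length bounds their number whether or not
  they are distinct.\<close>

lemma ex_vertex_avoiding:
  assumes "length xs < card V"
  shows "\<exists>v \<in> V. v \<notin> set xs"
proof (rule ccontr)
  assume "\<not> (\<exists>v \<in> V. v \<notin> set xs)"
  then have "V \<subseteq> set xs" by blast
  then have "card V \<le> card (set xs)"
    by (simp add: card_mono)
  with assms card_length[of xs] show False by simp
qed

lemma ex_nb_avoiding:
  assumes "cubic_on V E" "v \<in> V"
  obtains u where "{v, u} \<in> E" "u \<noteq> x" "u \<noteq> y"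
proof -
  obtain a b c where "distinct [a, b, c]" "nb E v = {a, b, c}"
    using nb_obtain[OF assms] .
  then have "\<exists>u \<in> nb E v. u \<noteq> x \<and> u \<noteq> y" by auto
  then show thesis using that by (auto simp: nb_def)
qed

text \<open>A make move along the path \<open>p a b d q\<close> adds the missing edge
  \<open>ad\<close> of the diamond.\<close>

lemma diamond_reaches_K4_direct:
  assumes "{a, b} \<in> E" "{a, c} \<in> E" "{b, c} \<in> E" "{b, d} \<in> E" "{c, d} \<in> E"
    and "{a, p} \<in> E" "{d, q} \<in> E" "{p, q} \<notin> E" "distinct [a, b, c, d, p, q]"
  shows "reaches_K4 E"
proof (cases "{a, d} \<in> E")
  case True
  then have "has_K4 E"
    using assms by (intro has_K4I[of a b c d]) auto
  then show ?thesis
    by (auto simp: reaches_K4_def)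
next
  case False
  let ?F = "(E - {{a, p}, {d, q}}) \<union> {{a, d}, {p, q}}"
  have "make_move p a b d q E ?F"
    using assms False by (auto simp: make_move_def insert_commute)
  then have "reach E ?F"
    unfolding triangle_move_def by (intro r_into_rtranclp) blast
  moreover have "has_K4 ?F"
    using assms by (intro has_K4I[of a b c d]) (auto simp: doubleton_eq_iff)
  ultimately show ?thesis
    by (auto simp: reaches_K4_def)
qed

text \<open>For use when \<open>t = u\<close> or \<open>tu\<close> is an edge, which blocks the
  direct make move. Switching \<open>at\<close> with a distant edge \<open>rs\<close> at the
  triangle \<open>abc\<close> turns the outer neighbour of \<open>a\<close> into \<open>r\<close>,
  which is not adjacent to \<open>u\<close>.\<close>

lemma diamond_reaches_K4_via_edge:
  assumes E: "cubic_on V E" and d: "distinct [a, b, c, d]"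
    and D: "{a, b} \<in> E" "{a, c} \<in> E" "{b, c} \<in> E" "{b, d} \<in> E" "{c, d} \<in> E" "{a, d} \<notin> E"
    and o: "{a, t} \<in> E" "{d, u} \<in> E" "t \<notin> {b, c}" "u \<notin> {b, c}"
    and e: "{r, s} \<in> E" "{r, s} \<inter> {a, b, c, d, t} = {}" "{t, s} \<notin> E" "{u, r} \<notin> E" "u \<noteq> r"
  shows "reaches_K4 E"
proof -
  let ?F = "switch a t r s E"
  have ne: "a \<noteq> t" "d \<noteq> u" "r \<noteq> s" "d \<noteq> t" "a \<noteq> u"
    using cubic_on_edgeD(1)[OF E o(1)] cubic_on_edgeD(1)[OF E o(2)] cubic_on_edgeD(1)[OF E e(1)] D o
    by (auto simp: insert_commute)
  have n1: "nb E a = {b, c, t}"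
    using D o d by (intro nb_eqI[OF E]) (auto simp: insert_commute)
  have n2: "nb E b = {a, c, d}"
    using D o d by (intro nb_eqI[OF E]) (auto simp: insert_commute)
  note n = n1 n2
  have "r \<notin> nb E a" "s \<notin> nb E b"
    unfolding n using e by auto
  then have "reach E ?F"
    using D o e d ne by (intro reach_switch[of a b E c]) (auto simp: in_nb_iff)
  moreover have "reaches_K4 ?F"
    using D o e d ne
    by (intro diamond_reaches_K4_direct[of a b _ c d r u])
      (auto simp: switch_def doubleton_eq_iff insert_commute)
  ultimately show ?thesis
    by (rule reaches_K4_trans)
qed

text \<open>The outer neighbours \<open>t\<close> of \<open>a\<close> and \<open>u\<close> of
  \<open>d\<close> either allow the direct move, or coincide, or are adjacent. In the last two cases
  a distant edge \<open>rs\<close> is found by counting: at most seven vertices have to be avoided,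
  hence the bound eight.\<close>

lemma diamond_reaches_K4:
  assumes E: "cubic_on V E" and V: "card V \<ge> 8" and d: "distinct [a, b, c, d]"
    and D: "{a, b} \<in> E" "{a, c} \<in> E" "{b, c} \<in> E" "{b, d} \<in> E" "{c, d} \<in> E"
  shows "reaches_K4 E"
proof (cases "{a, d} \<in> E")
  case True
  then have "has_K4 E"
    using D d by (intro has_K4I[of a b c d]) auto
  then show ?thesis
    by (auto simp: reaches_K4_def)
next
  case False
  obtain t where t: "distinct [a, b, c, t]" "nb E a = {b, c, t}"
    using nb_obtain2[OF E D(1,2)] d by auto
  obtain u where u: "distinct [d, b, c, u]" "nb E d = {b, c, u}"
    using nb_obtain2[OF E, of d b c] D d by (auto simp: insert_commute)
  have n1: "nb E b = {a, c, d}"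
    using D d by (intro nb_eqI[OF E]) (auto simp: insert_commute)
  have n2: "nb E c = {a, b, d}"
    using D d by (intro nb_eqI[OF E]) (auto simp: insert_commute)
  note n = n1 n2
  have out: "{a, t} \<in> E" "{d, u} \<in> E"
    using t u by (auto simp flip: in_nb_iff)
  have td: "t \<noteq> d" "u \<noteq> a"
    using False out by (auto simp: insert_commute)
  have via: "reaches_K4 E"
    if "{r, s} \<in> E" "{r, s} \<inter> {a, b, c, d, t} = {}" "{t, s} \<notin> E" "{u, r} \<notin> E" "u \<noteq> r" for r s
    using diamond_reaches_K4_via_edge[OF E d D False out _ _ that] t u by auto
  consider "t \<noteq> u" "{t, u} \<notin> E" | "t = u" | "{t, u} \<in> E" by blast
  then show ?thesis
  proof cases
    case 1
    then show ?thesis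
      using D d t(1) u(1) td out by (intro diamond_reaches_K4_direct[of a b E c d t u]) auto
  next
    case 2
    then obtain w where w: "nb E t = {a, d, w}"
      using nb_obtain2[OF E, of t a d] out d by (auto simp: insert_commute)
    obtain s where s: "s \<in> V" "s \<notin> {a, b, c, d, t, w}"
      using ex_vertex_avoiding[of "[a, b, c, d, t, w]" V] V by auto
    obtain r where r: "{s, r} \<in> E" "r \<noteq> w"
      using ex_nb_avoiding[OF E s(1)] by metis
    have "s \<notin> nb E a" "s \<notin> nb E b" "s \<notin> nb E c" "s \<notin> nb E d" "s \<notin> nb E t"
      using s n t u w 2 by auto
    with r have r': "r \<notin> {a, b, c, d, t}"
      by (auto simp: edge_iff_nb(2))
    then have "r \<notin> nb E t"
      using w r by auto
    with r r' s \<open>s \<notin> nb E t\<close> 2 show ?thesis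
      by (intro via[of r s]) (auto simp: in_nb_iff insert_commute)
  next
    case 3
    then have "t \<noteq> u"
      using cubic_on_edgeD(1)[OF E] by blast
    obtain g where g: "distinct [t, a, u, g]" "nb E t = {a, u, g}"
      using nb_obtain2[OF E, of t a u] 3 out td by (auto simp: insert_commute)
    obtain h where h: "distinct [u, d, t, h]" "nb E u = {d, t, h}"
      using nb_obtain2[OF E, of u d t] 3 out td by (auto simp: insert_commute)
    \<comment> \<open>The vertex \<open>s\<close> is away from the diamond and from
      \<open>t\<close>, \<open>u\<close> and all neighbours of \<open>t\<close>. A neighbour
      \<open>r\<close> of \<open>s\<close> other than \<open>g\<close> and \<open>u\<close> is not
      adjacent to \<open>t\<close> either; only \<open>r = h\<close> makes it adjacent to
      \<open>u\<close>.\<close>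
    obtain s where s: "s \<in> V" "s \<notin> {a, b, c, d, t, u, g}"
      using ex_vertex_avoiding[of "[a, b, c, d, t, u, g]" V] V by auto
    obtain r where r: "{s, r} \<in> E" "r \<noteq> g" "r \<noteq> u"
      using ex_nb_avoiding[OF E s(1)] by metis
    have s': "s \<notin> nb E a" "s \<notin> nb E b" "s \<notin> nb E c" "s \<notin> nb E d" "s \<notin> nb E t"
      using s n t u g by auto
    with r have r': "r \<notin> {a, b, c, d, t}"
      by (auto simp: edge_iff_nb(2))
    then have rt: "r \<notin> nb E t"
      using g r by auto
    show ?thesis
    proof (cases "r = h")
      case False
      then have "r \<notin> nb E u"
        using r' h by auto
      with r r' s s' show ?thesis
        by (intro via[of r s]) (auto simp: in_nb_iff insert_commute)
    next
      case True
      \<comment> \<open>Here \<open>r\<close> is adjacent to \<open>u\<close> but \<open>s\<close>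
        is not, so the edge is used with its ends exchanged.\<close>
      then have "s \<noteq> h"
        using r cubic_on_edgeD(1)[OF E] by blast
      then have "s \<notin> nb E u"
        using s h by auto
      with r r' s rt show ?thesis
        by (intro via[of s r]) (auto simp: in_nb_iff insert_commute)
    qed
  qed
qed

section \<open>From a triangle to a diamond\<close>

text \<open>Switching \<open>bq\<close> with \<open>ps\<close> makes \<open>p\<close> a common
  neighbour of \<open>a\<close> and \<open>b\<close>, so \<open>c\<close>, \<open>a\<close>,
  \<open>b\<close>, \<open>p\<close> span a diamond.\<close>

lemma triangle_reaches_K4_by_one_switch:
  assumes E: "cubic_on V E" and V: "card V \<ge> 8"
    and T: "{a, b} \<in> E" "{b, c} \<in> E" "{a, c} \<in> E" "{a, p} \<in> E" "{b, q} \<in> E"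
    and s: "{p, s} \<in> E" "{q, s} \<notin> E" and d: "distinct [a, b, c, p, q, s]"
  shows "reaches_K4 E"
proof -
  let ?F = "switch b q p s E"
  have n1: "nb E a = {b, c, p}"
    using T d by (intro nb_eqI[OF E]) (auto simp: insert_commute)
  have n2: "nb E b = {a, c, q}"
    using T d by (intro nb_eqI[OF E]) (auto simp: insert_commute)
  note n = n1 n2
  have "p \<notin> nb E b" "s \<notin> nb E a"
    unfolding n using d by auto
  then have r: "reach E ?F"
    using T s d by (intro reach_switch[of b a E c]) (auto simp: in_nb_iff insert_commute)
  have "reaches_K4 ?F"
    using T s d
    by (intro diamond_reaches_K4[OF cubic_on_reach[OF r E] V, of c a b p])
      (auto simp: switch_def doubleton_eq_iff insert_commute)
  with r show ?thesis
    by (rule reaches_K4_trans)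
qed

text \<open>The first switch, of \<open>ap\<close> with \<open>rs\<close>, replaces the outer
  neighbour \<open>p\<close> of \<open>a\<close> by \<open>r\<close>; then \<open>s'\<close> is a
  neighbour of \<open>r\<close> as the one-switch lemma demands. As the first switch creates
  \<open>ps\<close>, this edge has to differ from \<open>qs'\<close>.\<close>

lemma triangle_reaches_K4_by_two_switches:
  assumes E: "cubic_on V E" and V: "card V \<ge> 8"
    and T: "{a, b} \<in> E" "{b, c} \<in> E" "{a, c} \<in> E" "{a, p} \<in> E" "{b, q} \<in> E"
    and r: "{r, s} \<in> E" "{r, s'} \<in> E" "s \<noteq> s'" "{r, s, s'} \<inter> {a, b, c} = {}" "r \<noteq> p" "r \<noteq> q"
    and s: "{p, s} \<notin> E" "p \<noteq> s" "{q, s'} \<notin> E" "q \<noteq> s'" "{c, s} \<notin> E" "{p, s} \<noteq> {q, s'}"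
    and d: "distinct [a, b, c, p, q]"
  shows "reaches_K4 E"
proof -
  let ?F = "switch a p r s E"
  have n: "nb E a = {b, c, p}"
    using T d by (intro nb_eqI[OF E]) (auto simp: insert_commute)
  have "r \<notin> nb E a"
    unfolding n using r d by auto
  moreover have rs: "r \<noteq> s" "r \<noteq> s'"
    using r cubic_on_edgeD(1)[OF E] by blast+
  \<comment> \<open>The triangle is broken at \<open>ac\<close> rather than \<open>ab\<close>, so
    that \<open>s\<close> may be adjacent to \<open>b\<close>, as happens when
    \<open>s = q\<close>.\<close>
  ultimately have R: "reach E ?F"
    using T s r d by (intro reach_switch[of a c E b]) (auto simp: in_nb_iff insert_commute)
  have "{q, s'} \<notin> ?F"
    using s r d by (auto simp: switch_def doubleton_eq_iff)
  moreover have "{a, b} \<in> ?F" "{b, c} \<in> ?F" "{a, c} \<in> ?F" "{a, r} \<in> ?F" "{b, q} \<in> ?F" "{r, s'} \<in> ?F"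
    using T r s d rs by (auto simp: switch_def doubleton_eq_iff)
  ultimately have "reaches_K4 ?F"
    using r s d rs
    by (intro triangle_reaches_K4_by_one_switch[OF cubic_on_reach[OF R E] V, of a b c r q s']) auto
  with R show ?thesis
    by (rule reaches_K4_trans)
qed

text \<open>If two of the outer neighbours \<open>p\<close>, \<open>q\<close>, \<open>t\<close>
  coincide, there is a diamond. Otherwise the failure of every single switch forces neighbours of
  \<open>p\<close> to be neighbours of \<open>q\<close> and of \<open>t\<close> too. This leaves two
  exceptional components, both resolved by two switches.\<close>

lemma triangle_reaches_K4:
  assumes E: "cubic_on V E" and V: "card V \<ge> 8"
    and T: "{a, b} \<in> E" "{b, c} \<in> E" "{a, c} \<in> E"
  shows "reaches_K4 E"
proof -
  have abc: "distinct [a, b, c]"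
    using T cubic_on_edgeD(1)[OF E] by auto
  obtain p where p: "distinct [a, b, c, p]" "nb E a = {b, c, p}"
    using nb_obtain2[OF E, of a b c] T abc by (auto simp: insert_commute)
  obtain q where q: "distinct [b, a, c, q]" "nb E b = {a, c, q}"
    using nb_obtain2[OF E, of b a c] T abc by (auto simp: insert_commute)
  obtain t where t: "distinct [c, a, b, t]" "nb E c = {a, b, t}"
    using nb_obtain2[OF E, of c a b] T abc by (auto simp: insert_commute)
  have out: "{a, p} \<in> E" "{b, q} \<in> E" "{c, t} \<in> E"
    by (simp_all add: edge_iff_nb(1) p(2) q(2) t(2))
  consider "p = q" | "p = t" | "q = t" | "distinct [p, q, t]" by auto
  then show ?thesis
  proof cases
    case 1
    then show ?thesis
      using T out p(1) q(1) t(1) by (intro diamond_reaches_K4[OF E V, of c a b p]) (auto simp: insert_commute)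
  next
    case 2
    then show ?thesis
      using T out p(1) q(1) t(1) by (intro diamond_reaches_K4[OF E V, of b a c p]) (auto simp: insert_commute)
  next
    case 3
    then show ?thesis
      using T out p(1) q(1) t(1) by (intro diamond_reaches_K4[OF E V, of a b c q]) (auto simp: insert_commute)
  next
    case 4
    have d: "distinct [a, b, c, p, q, t]"
      using 4 p q t by auto
    have nbc: "p \<notin> nb E b" "p \<notin> nb E c" "q \<notin> nb E a" "q \<notin> nb E c" "t \<notin> nb E a" "t \<notin> nb E b"
      using p q t d by auto
    show ?thesis
    proof (rule ccontr)
      assume not: "\<not> reaches_K4 E"
      have *: "s = a \<or> s = q \<or> {q, s} \<in> E" if "{p, s} \<in> E" for s
      proof (rule ccontr)
        assume s: "\<not> (s = a \<or> s = q \<or> {q, s} \<in> E)"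
        have "s \<noteq> b" "s \<noteq> c" "s \<noteq> p"
          using that nbc cubic_on_edgeD(1)[OF E] by (auto simp: edge_iff_nb(2))
        with s d that not show False
          using triangle_reaches_K4_by_one_switch[OF E V T out(1,2), of s] by auto
      qed
      have **: "s = a \<or> s = t \<or> {t, s} \<in> E" if "{p, s} \<in> E" for s
      proof (rule ccontr)
        assume s: "\<not> (s = a \<or> s = t \<or> {t, s} \<in> E)"
        have "s \<noteq> b" "s \<noteq> c" "s \<noteq> p"
          using that nbc cubic_on_edgeD(1)[OF E] by (auto simp: edge_iff_nb(2))
        with s d that not show False
          using triangle_reaches_K4_by_one_switch[OF E V T(3) _ T(1) out(1,3), of s] T(2)
          by (auto simp: insert_commute)
      qed
      show False
      proof (cases "{p, q} \<in> E")
        case True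
        \<comment> \<open>the component of the triangle is a prism, and \<open>r\<close> is taken from another component\<close>
        then obtain s where s: "distinct [p, a, q, s]" "nb E p = {a, q, s}"
          using nb_obtain2[OF E, of p a q] out d by (auto simp: insert_commute)
        then have "{q, s} \<in> E" "{t, q} \<in> E"
          using *[of s] **[of q] d by (auto simp: edge_iff_nb(1))
        then have nq: "nb E q = {b, p, t}"
          using True out d by (intro nb_eqI[OF E]) (auto simp: insert_commute)
        have "{p, s} \<in> E"
          using s by (simp add: edge_iff_nb(1))
        then have "s \<noteq> b"
          using nbc by (auto simp: edge_iff_nb(2))
        then have "s = t"
          using nq \<open>{q, s} \<in> E\<close> s(1) by (auto simp: edge_iff_nb(1))
        have np: "nb E p = {a, q, t}"
          using s(2) unfolding \<open>s = t\<close> .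
        then have pt: "{p, t} \<in> E"
          by (simp add: edge_iff_nb(1))
        have nt: "nb E t = {c, p, q}"
          using \<open>{t, q} \<in> E\<close> pt out d by (intro nb_eqI[OF E]) (auto simp: insert_commute)
        obtain r where r: "r \<in> V" "r \<notin> {a, b, c, p, q, t}"
          using ex_vertex_avoiding[of "[a, b, c, p, q, t]" V] V by auto
        obtain x y z where x: "distinct [x, y, z]" "nb E r = {x, y, z}"
          using nb_obtain[OF E r(1)] .
        have rx: "{r, x} \<in> E" "{r, y} \<in> E"
          using x by (auto simp: edge_iff_nb(1))
        have far: "r \<notin> nb E v" if "v \<in> {a, b, c, p, q, t}" for v
          using that r p(2) q(2) t(2) np nq nt by auto
        then have "{x, y} \<inter> {a, b, c, p, q, t} = {}"
          using rx by (auto simp: edge_iff_nb(2))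
        moreover from this have "x \<notin> nb E p" "y \<notin> nb E q" "x \<notin> nb E c"
          using np nq t(2) by auto
        ultimately have "reaches_K4 E"
          using r x rx d
          by (intro triangle_reaches_K4_by_two_switches[OF E V T out(1,2), of r x y])
            (auto simp: in_nb_iff doubleton_eq_iff)
        with not show False ..
      next
        case False
        \<comment> \<open>the component is \<open>K\<^sub>3\<^sub>,\<^sub>3\<close> with one vertex blown up to the triangle\<close>
        obtain x y where x: "distinct [p, a, x, y]" "nb E p = {a, x, y}"
          using nb_obtain1[OF E, of p a] out by (auto simp: insert_commute)
        have px: "{p, x} \<in> E" "{p, y} \<in> E"
          using x by (auto simp: edge_iff_nb(1))
        then have "x \<noteq> q" "y \<noteq> q"
          using False by auto
        then have qx: "{q, x} \<in> E" "{q, y} \<in> E"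
          using *[OF px(1)] *[OF px(2)] x by auto
        have bxy: "x \<notin> {b, c}" "y \<notin> {b, c}"
          using px nbc by (auto simp: edge_iff_nb(2))
        then have nq: "nb E q = {b, x, y}"
          using qx out x by (intro nb_eqI[OF E]) (auto simp: insert_commute)
        \<comment> \<open>If one of \<open>x\<close>, \<open>y\<close> were \<open>t\<close>, then
          \<open>t\<close> would have the neighbours \<open>c\<close>, \<open>p\<close>,
          \<open>q\<close>, yet \<open>**\<close> makes it adjacent to the other one as
          well.\<close>
        have "x \<noteq> t" "y \<noteq> t"
        proof -
          show "x \<noteq> t"
          proof
            assume "x = t"
            then have "nb E t = {c, p, q}"
              using out px qx d by (intro nb_eqI[OF E]) (auto simp: insert_commute)
            moreover have "{t, y} \<in> E"
              using **[OF px(2)] x \<open>x = t\<close> by auto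
            ultimately show False
              using x bxy \<open>y \<noteq> q\<close> by (auto simp: edge_iff_nb(1))
          qed
          show "y \<noteq> t"
          proof
            assume "y = t"
            then have "nb E t = {c, p, q}"
              using out px qx d by (intro nb_eqI[OF E]) (auto simp: insert_commute)
            moreover have "{t, x} \<in> E"
              using **[OF px(1)] x \<open>y = t\<close> by auto
            ultimately show False
              using x bxy \<open>x \<noteq> q\<close> by (auto simp: edge_iff_nb(1))
          qed
        qed
        then have tx: "{t, x} \<in> E"
          using **[OF px(1)] x by auto
        have "{q, t} \<notin> E" "{c, q} \<notin> E"
          using nq nbc d \<open>x \<noteq> t\<close> \<open>y \<noteq> t\<close> by (auto simp: edge_iff_nb(1))
        \<comment> \<open>The first switch exchanges \<open>ap\<close>, \<open>xq\<close> for
          \<open>ax\<close>, \<open>pq\<close>, the second \<open>bq\<close>, \<open>xt\<close> for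
          \<open>bx\<close>, \<open>qt\<close>; then \<open>x\<close> is adjacent to both
          \<open>a\<close> and \<open>b\<close>.\<close>
        then have "reaches_K4 E"
          using False x bxy qx tx d \<open>x \<noteq> q\<close> \<open>x \<noteq> t\<close>
          by (intro triangle_reaches_K4_by_two_switches[OF E V T out(1,2), of x q t])
            (auto simp: doubleton_eq_iff insert_commute)
        with not show False ..
      qed
    qed
  qed
qed

section \<open>Creating a triangle\<close>

text \<open>A graph that reaches no K4 has no triangle and admits no make move, since that move
  creates a triangle. These two facts determine the graph around a vertex so tightly that some
  vertex gets a fourth neighbour.\<close>

lemma cubic_on_reaches_K4:
  assumes E: "cubic_on V E" and V: "card V \<ge> 8"
  shows "reaches_K4 E"
proof (rule ccontr)
  assume not: "\<not> reaches_K4 E"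
  have tf: False if "{x, y} \<in> E" "{y, z} \<in> E" "{x, z} \<in> E" for x y z
    using triangle_reaches_K4[OF E V that] not by simp
  have nomove: "y = z \<or> {y, z} \<in> E"
    if e: "{v, x} \<in> E" "{v, w} \<in> E" "x \<noteq> w" "{x, y} \<in> E" "y \<noteq> v" "{w, z} \<in> E" "z \<noteq> v" for v x w y z
  proof (rule ccontr)
    assume n: "\<not> (y = z \<or> {y, z} \<in> E)"
    let ?F = "(E - {{x, y}, {w, z}}) \<union> {{x, w}, {y, z}}"
    have xw: "{x, w} \<notin> E"
      using tf[of v x w] e by blast
    have d: "distinct [y, x, v, w, z]"
      using e n xw cubic_on_edgeD(1)[OF E e(1)] cubic_on_edgeD(1)[OF E e(2)]
        cubic_on_edgeD(1)[OF E e(4)] cubic_on_edgeD(1)[OF E e(6)] by (auto simp: insert_commute)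
    have "make_move y x v w z E ?F"
      using e n xw d by (auto simp: make_move_def insert_commute)
    then have r: "reach E ?F"
      unfolding triangle_move_def by (intro r_into_rtranclp) blast
    have "reaches_K4 ?F"
      using e d
      by (intro triangle_reaches_K4[OF cubic_on_reach[OF r E] V, of v x w])
        (auto simp: doubleton_eq_iff)
    with r not show False
      using reaches_K4_trans by blast
  qed
  obtain v where "v \<in> V"
    using V by fastforce
  then obtain x w u where n: "distinct [x, w, u]" "nb E v = {x, w, u}"
    using nb_obtain[OF E] by metis
  have vE: "{v, x} \<in> E" "{v, w} \<in> E" "{v, u} \<in> E"
    using n by (auto simp: edge_iff_nb(1))
  \<comment> \<open>If \<open>y = z\<close>, then \<open>nomove\<close> applied to \<open>y\<close>
    and \<open>z'\<close> gives the edge \<open>zz'\<close>, which closes a triangle with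
    \<open>w\<close>; likewise for \<open>y = z'\<close>.\<close>
  have adj: "{y, z} \<in> E \<and> {y, z'} \<in> E"
    if e: "{v, x} \<in> E" "{v, w} \<in> E" "x \<noteq> w" "{x, y} \<in> E" "y \<noteq> v"
      "{w, z} \<in> E" "z \<noteq> v" "{w, z'} \<in> E" "z' \<noteq> v" "z \<noteq> z'" for x w y z z'
  proof -
    have "y = z \<or> {y, z} \<in> E" "y = z' \<or> {y, z'} \<in> E"
      using nomove[OF e(1-5)] e by auto
    moreover have "{z, z'} \<notin> E"
      using tf[of z w z'] e by (auto simp: insert_commute)
    ultimately show ?thesis
      using e by (auto simp: insert_commute)
  qed
  obtain y y' where y: "distinct [x, v, y, y']" "nb E x = {v, y, y'}"
    using nb_obtain1[OF E, of x v] vE by (auto simp: insert_commute)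
  obtain z z' where z: "distinct [w, v, z, z']" "nb E w = {v, z, z'}"
    using nb_obtain1[OF E, of w v] vE by (auto simp: insert_commute)
  obtain g g' where g: "distinct [u, v, g, g']" "nb E u = {v, g, g'}"
    using nb_obtain1[OF E, of u v] vE by (auto simp: insert_commute)
  have yE: "{x, y} \<in> E" "{x, y'} \<in> E" "{w, z} \<in> E" "{w, z'} \<in> E" "{u, g} \<in> E" "{u, g'} \<in> E"
    using y z g by (auto simp: edge_iff_nb(1))
  have yz: "{y, z} \<in> E" "{y, z'} \<in> E" "{y', z} \<in> E" "{y', z'} \<in> E" "{y, g} \<in> E" "{y, g'} \<in> E"
    using adj[of x w y z z'] adj[of x w y' z z'] adj[of x u y g g'] vE yE n y z g by auto
  have "z \<noteq> x" "z' \<noteq> x"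
    using tf[of v x w] vE yE by (auto simp: insert_commute)
  then have "nb E y = {x, z, z'}"
    using yE yz z by (intro nb_eqI[OF E]) (auto simp: insert_commute)
  moreover have "g \<noteq> x" "g' \<noteq> x"
    using tf[of v x u] vE yE by (auto simp: insert_commute)
  \<comment> \<open>Besides \<open>x\<close>, the vertex \<open>y\<close> has only the neighbours
    \<open>z\<close> and \<open>z'\<close>, so \<open>g\<close> and \<open>g'\<close> are these two.
    Then \<open>u\<close> is a neighbour of \<open>z\<close> in addition to \<open>w\<close>,
    \<open>y\<close>, \<open>y'\<close>.\<close>
  ultimately have "z \<in> {g, g'}"
    using yz g by (auto simp: edge_iff_nb(1))
  then have "{z, u} \<in> E"
    using yE by (auto simp: insert_commute)
  moreover have "y \<noteq> w" "y' \<noteq> w"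
    using tf[of v x w] vE yE by auto
  then have "nb E z = {w, y, y'}"
    using yE yz y by (intro nb_eqI[OF E]) (auto simp: insert_commute)
  moreover have "y \<noteq> u" "y' \<noteq> u"
    using tf[of v x u] vE yE by auto
  ultimately show False
    using n by (auto simp: edge_iff_nb(1))
qed

definition has_K4' :: nat where "has_K4' = 0"

section \<open>K4 components\<close>

lemma nb_complete_on: "v \<in> K \<Longrightarrow> nb (complete_on K) v = K - {v}"
  by (auto simp: nb_def complete_on_def card_2_iff doubleton_eq_iff)

lemma cubic_on_complete_on:
  assumes "card K = 4"
  shows "cubic_on K (complete_on K)"
  using assms by (auto simp: cubic_on_def nb_complete_on) (auto simp: complete_on_def)

lemma cubic_on_4:
  assumes E: "cubic_on V E" and V: "card V = 4"
  shows "E = complete_on V"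
proof
  show "E \<subseteq> complete_on V"
    using E by (auto simp: cubic_on_def complete_on_def)
  have f: "finite V"
    using V by (intro card_ge_0_finite) simp
  have n: "nb E v = V - {v}" if "v \<in> V" for v
  proof (rule card_subset_eq)
    show "nb E v \<subseteq> V - {v}"
      using cubic_on_edgeD(1)[OF E, of v v] cubic_on_edgeD(3)[OF E] by (auto simp: in_nb_iff)
    show "card (nb E v) = card (V - {v})"
      using E V that by (auto simp: cubic_on_def)
  qed (use f in simp)
  show "complete_on V \<subseteq> E"
  proof
    fix e assume "e \<in> complete_on V"
    then obtain x y where e: "e = {x, y}" "x \<noteq> y" "x \<in> V" "y \<in> V"
      by (auto simp: complete_on_def card_2_iff)
    then have "y \<in> nb E x"
      using n by simp
    with e show "e \<in> E"
      by (simp add: in_nb_iff)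
  qed
qed

lemma cubic_on_Un:
  assumes "cubic_on V E" "cubic_on W F" "V \<inter> W = {}"
  shows "cubic_on (V \<union> W) (E \<union> F)"
proof -
  have "nb (E \<union> F) v = (if v \<in> V then nb E v else nb F v)" if "v \<in> V \<union> W" for v
    using that assms(3) cubic_on_edgeD(2)[OF assms(1)] cubic_on_edgeD(2)[OF assms(2)]
    by (auto simp: nb_def)
  then show ?thesis
    using assms(1,2) by (auto simp: cubic_on_def)
qed

text \<open>A disjoint union of copies of K4. It shows that the move graph has a vertex, and it
  fills up the vertices outside two prescribed copies in \<open>reach_any_K4\<close>.\<close>

lemma ex_cubic_on:
  assumes "finite V" "4 dvd card V"
  shows "\<exists>E. cubic_on V E"
  using assms
proof (induction "card V" arbitrary: V rule: less_induct)
  case less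
  show ?case
  proof (cases "V = {}")
    case True
    then show ?thesis
      by (auto simp: cubic_on_def)
  next
    case False
    with less have "4 \<le> card V"
      by (intro dvd_imp_le) (auto simp: card_gt_0_iff)
    then obtain K where K: "K \<subseteq> V" "card K = 4"
      using obtain_subset_with_card_n by metis
    then have c: "card (V - K) = card V - 4"
      using less.prems by (simp add: card_Diff_subset finite_subset)
    with less \<open>4 \<le> card V\<close> obtain E where "cubic_on (V - K) E"
      by (metis diff_less dvd_diff_nat dvd_refl finite_Diff less_le_trans zero_less_numeral)
    with K have "cubic_on (K \<union> (V - K)) (complete_on K \<union> E)"
      by (intro cubic_on_Un cubic_on_complete_on) auto
    with K show ?thesis
      by (auto simp: Un_absorb1)
  qed
qed

text \<open>The other three vertices of \<open>K\<close> are all the neighbours of a vertex in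
  \<open>K\<close>, so no edge leaves \<open>K\<close> and \<open>H\<close> consists of the edges
  disjoint from it.\<close>

lemma K4_split:
  assumes E: "cubic_on V E" and K: "card K = 4" "complete_on K \<subseteq> E"
  obtains H where "K \<subseteq> V" "cubic_on (V - K) H" "E = complete_on K \<union> H"
proof -
  have f: "finite K"
    using K by (intro card_ge_0_finite) simp
  have KV: "K \<subseteq> V"
  proof
    fix x assume x: "x \<in> K"
    have "K \<noteq> {x}"
      using K by auto
    with x obtain y where "y \<in> K" "y \<noteq> x" by blast
    with x have "{x, y} \<in> complete_on K"
      by (auto simp: complete_on_def)
    with K show "x \<in> V"
      using cubic_on_edgeD[OF E] by blast
  qed
  have n: "nb E x = K - {x}" if "x \<in> K" for x
  proof (rule card_subset_eq[symmetric])
    have c: "card (nb E x) = 3"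
      using E that KV by (auto simp: cubic_on_def)
    then show "finite (nb E x)"
      by (intro card_ge_0_finite) simp
    show "K - {x} \<subseteq> nb E x"
      using K(2) that by (auto simp: nb_def complete_on_def)
    show "card (K - {x}) = card (nb E x)"
      using c K that by simp
  qed
  let ?H = "{e \<in> E. e \<inter> K = {}}"
  have "E \<subseteq> complete_on K \<union> ?H"
  proof
    fix e assume e: "e \<in> E"
    show "e \<in> complete_on K \<union> ?H"
    proof (cases "e \<inter> K = {}")
      case False
      then obtain x where x: "x \<in> e" "x \<in> K" by blast
      have "card e = 2"
        using E e by (auto simp: cubic_on_def)
      with x obtain y where "e = {x, y}" "x \<noteq> y"
        by (auto simp: card_2_iff)
      with x e n[of x] have "y \<in> K"
        by (auto simp: nb_def)
      with x \<open>e = {x, y}\<close> \<open>x \<noteq> y\<close> show ?thesis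
        by (auto simp: complete_on_def)
    qed (use e in simp)
  qed
  with K have eq: "E = complete_on K \<union> ?H" by blast
  have "nb ?H v = nb E v" if "v \<in> V - K" for v
  proof -
    have "u \<notin> K" if u: "u \<in> nb E v" for u
    proof
      assume "u \<in> K"
      moreover have "v \<in> nb E u"
        using u by (simp add: in_nb_iff insert_commute)
      ultimately show False
        using n \<open>v \<in> V - K\<close> by auto
    qed
    then show ?thesis
      using that by (auto simp: nb_def)
  qed
  then have "cubic_on (V - K) ?H"
    using E by (auto simp: cubic_on_def)
  with KV eq show thesis
    by (intro that)
qed

section \<open>Exchanging vertices between two K4 components\<close>

text \<open>Evaluates the three exchanges of \<open>reach_swap_K4\<close>: \<open>B\<close> holds
  the edges of the two triangles that stay, \<open>ai\<close> and \<open>bi\<close> are the old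
  edges at \<open>x\<close> and \<open>y\<close>, \<open>ci\<close> and \<open>di\<close> the new
  ones.\<close>

lemma exchange_three:
  assumes "{a1, a2, a3, b1, b2, b3} \<inter> B = {}" "distinct [a1, a2, a3, b1, b2, b3]"
    and "{a1, a2, a3, b1, b2, b3} \<inter> {c1, c2, c3, d1, d2, d3} = {}"
    and "E1 = (B \<union> {a1, a2, a3, b1, b2, b3}) - {a1, b3} \<union> {c1, d3}"
    and "E2 = E1 - {a2, b1} \<union> {c2, d1}" "E3 = E2 - {a3, b2} \<union> {c3, d2}"
  shows "E1 = B \<union> {c1, a2, a3, b1, b2, d3}" "E2 = B \<union> {c1, c2, a3, d1, b2, d3}"
    "E3 = B \<union> {c1, c2, c3, d1, d2, d3}"
proof -
  show E1: "E1 = B \<union> {c1, a2, a3, b1, b2, d3}"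
    unfolding assms(4) using assms(1-3) by auto
  show E2: "E2 = B \<union> {c1, c2, a3, d1, b2, d3}"
    unfolding assms(5) E1 using assms(1-3) by auto
  show "E3 = B \<union> {c1, c2, c3, d1, d2, d3}"
    unfolding assms(6) E2 using assms(1-3) by auto
qed

text \<open>
  A break with \<open>k1 x\<close> and \<open>y l3\<close> joins the two complete graphs into a cycle of two diamonds. The
  remaining two edges at \<open>x\<close> and at \<open>y\<close> are then switched at the triangle \<open>k1 k2 k3\<close>.
\<close>
lemma reach_swap_K4:
  assumes d: "distinct [x, k1, k2, k3, y, l1, l2, l3]"
  shows "reach (complete_on {x, k1, k2, k3} \<union> complete_on {y, l1, l2, l3})
    (complete_on {y, k1, k2, k3} \<union> complete_on {x, l1, l2, l3})"
proof -
  let ?B = "{{k1, k2}, {k1, k3}, {k2, k3}, {l1, l2}, {l1, l3}, {l2, l3}}"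
  define E0 where "E0 = ?B \<union> {{k1, x}, {k2, x}, {k3, x}, {y, l1}, {y, l2}, {y, l3}}"
  define E1 where "E1 = (E0 - {{k1, x}, {y, l3}}) \<union> {{k1, y}, {x, l3}}"
  define E2 where "E2 = (E1 - {{k2, x}, {y, l1}}) \<union> {{k2, y}, {x, l1}}"
  define E3 where "E3 = (E2 - {{k3, x}, {y, l2}}) \<union> {{k3, y}, {x, l2}}"
  have "{{k1, x}, {k2, x}, {k3, x}, {y, l1}, {y, l2}, {y, l3}} \<inter> ?B = {}"
    "distinct [{k1, x}, {k2, x}, {k3, x}, {y, l1}, {y, l2}, {y, l3}]"
    "{{k1, x}, {k2, x}, {k3, x}, {y, l1}, {y, l2}, {y, l3}} \<inter>
      {{k1, y}, {k2, y}, {k3, y}, {x, l1}, {x, l2}, {x, l3}} = {}"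
    using d by (auto simp: doubleton_eq_iff)
  note E = exchange_three[OF this E1_def[unfolded E0_def] E2_def E3_def]
  have "break_move k2 k1 x y l3 E0 E1"
    unfolding break_move_def
    by (intro conjI E1_def) (use d in \<open>auto simp: E0_def doubleton_eq_iff\<close>)
  then have "triangle_move E0 E1"
    unfolding triangle_move_def by blast
  moreover have "reach E1 (switch k2 x y l1 E1)"
    by (rule reach_switch[of k2 k1 E1 k3]) (use d in \<open>auto simp: E(1) doubleton_eq_iff\<close>)
  then have "reach E1 E2"
    by (simp add: switch_def E2_def)
  moreover have "reach E2 (switch k3 x y l2 E2)"
    by (rule reach_switch[of k3 k1 E2 k2]) (use d in \<open>auto simp: E(2) doubleton_eq_iff\<close>)
  then have "reach E2 E3"
    by (simp add: switch_def E3_def)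
  ultimately have "reach E0 E3"
    by (meson converse_rtranclp_into_rtranclp rtranclp_trans)
  moreover have "E0 = complete_on {x, k1, k2, k3} \<union> complete_on {y, l1, l2, l3}"
    using d by (simp add: E0_def complete_on_4) (simp add: insert_commute)
  moreover have d': "distinct [y, k1, k2, k3]" "distinct [x, l1, l2, l3]"
    using d by auto
  have "E3 = complete_on {y, k1, k2, k3} \<union> complete_on {x, l1, l2, l3}"
    unfolding E(3) complete_on_4[OF d'(1)] complete_on_4[OF d'(2)] by (simp add: insert_commute)
  ultimately show ?thesis
    by simp
qed

lemma reach_swap_K4_sets:
  assumes "card K = 4" "card L = 4" "K \<inter> L = {}" "x \<in> K" "y \<in> L"
  shows "reach (complete_on K \<union> complete_on L)
    (complete_on (insert y (K - {x})) \<union> complete_on (insert x (L - {y})))"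
proof -
  have "card (K - {x}) = 3" "card (L - {y}) = 3"
    using assms by simp_all
  then obtain k1 k2 k3 l1 l2 l3 where
    k: "K - {x} = {k1, k2, k3}" "distinct [k1, k2, k3]" and
    l: "L - {y} = {l1, l2, l3}" "distinct [l1, l2, l3]"
    by (auto simp: card_3_iff)
  then have eq: "K = {x, k1, k2, k3}" "L = {y, l1, l2, l3}"
    using assms by blast+
  have "distinct [x, k1, k2, k3, y, l1, l2, l3]"
    using k l eq assms(3) by auto
  then show ?thesis
    unfolding k(1) l(1) unfolding eq by (rule reach_swap_K4)
qed

section \<open>Induction on the number of vertices\<close>

text \<open>Induction on the number of vertices of \<open>K'\<close> missing from \<open>K\<close>.
  By \<open>IH\<close> the graph outside \<open>K\<close> can be rearranged at will, in particular
  so that a wanted vertex \<open>y\<close> lies in a second K4; then \<open>y\<close> is traded for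
  a vertex \<open>x\<close> of \<open>K\<close> outside \<open>K'\<close>.\<close>

lemma reach_any_K4:
  assumes V: "finite V" "card V \<ge> 8" "4 dvd card V"
    and IH: "\<And>K H H'. K \<subseteq> V \<Longrightarrow> card K = 4 \<Longrightarrow>
      cubic_on (V - K) H \<Longrightarrow> cubic_on (V - K) H' \<Longrightarrow> reach H H'"
    and K: "K \<subseteq> V" "card K = 4" "cubic_on (V - K) H"
    and K': "K' \<subseteq> V" "card K' = 4" "cubic_on (V - K') H'"
  shows "reach (complete_on K \<union> H) (complete_on K' \<union> H')"
  using K
proof (induction "card (K' - K)" arbitrary: K H)
  have fix_K: "reach (complete_on K \<union> H) (complete_on K \<union> H')"
    if "K \<subseteq> V" "card K = 4" "cubic_on (V - K) H" "cubic_on (V - K) H'" for K H H'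
  proof -
    have "reach (H \<union> complete_on K) (H' \<union> complete_on K)"
      by (rule reach_Un[OF IH[OF that] that(3)]) (auto simp: complete_on_def)
    then show ?thesis
      by (simp add: Un_commute)
  qed
  {
    case 0
    have "finite K'"
      using K' V finite_subset by blast
    with 0 have "K' \<subseteq> K" by simp
    moreover have "finite K"
      using 0 V finite_subset by blast
    ultimately have "K' = K"
      using 0 K' by (metis card_subset_eq)
    with 0 K' show ?case
      using fix_K by simp
  next
    case (Suc n)
    have f: "finite K" "finite K'"
      using Suc.prems K' V finite_subset by blast+
    obtain y where y: "y \<in> K'" "y \<notin> K"
      using Suc.hyps(2) by (metis Diff_eq_empty_iff card.empty nat.distinct(1) subsetI)
    then have "\<not> K \<subseteq> K'"
      using f Suc.prems K' by (metis card_subset_eq)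
    then obtain x where x: "x \<in> K" "x \<notin> K'" by blast
    \<comment> \<open>Eight vertices leave room for a set \<open>L\<close> of four outside
      \<open>K\<close> that contains \<open>y\<close>.\<close>
    have "card (V - K) \<ge> 4"
      using V Suc.prems f by (simp add: card_Diff_subset)
    then have "card (V - K - {y}) \<ge> 3"
      using y K' by auto
    then obtain T where T: "T \<subseteq> V - K - {y}" "card T = 3"
      using obtain_subset_with_card_n by metis
    then have fT: "finite T"
      using V finite_subset by blast
    have yT: "y \<notin> T"
      using T by blast
    define L where "L = insert y T"
    define K1 where "K1 = insert y (K - {x})"
    define L1 where "L1 = insert x (L - {y})"
    have L: "L \<subseteq> V - K" "card L = 4" "y \<in> L"
      using T fT yT y K' by (auto simp: L_def)
    have K1: "K1 \<subseteq> V" "card K1 = 4"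
      using Suc.prems f x y K' by (auto simp: K1_def)
    have "L1 = insert x T"
      using yT by (auto simp: L1_def L_def)
    then have L1: "L1 \<subseteq> V" "card L1 = 4"
      using Suc.prems x fT T by (auto simp: card_insert_if)
    have W: "card (V - K - L) = card V - 8"
      using V L Suc.prems f fT by (simp add: card_Diff_subset L_def)
    have "4 dvd card (V - K - L)"
      unfolding W using V by (intro dvd_diff_nat) auto
    moreover have "finite (V - K - L)"
      using V by simp
    ultimately obtain M where M: "cubic_on (V - K - L) M"
      using ex_cubic_on by blast
    have "cubic_on (L \<union> (V - K - L)) (complete_on L \<union> M)"
      using L M by (intro cubic_on_Un cubic_on_complete_on) auto
    moreover have "L \<union> (V - K - L) = V - K"
      using L by blast
    ultimately have H1: "cubic_on (V - K) (complete_on L \<union> M)"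
      by simp
    have "cubic_on (L1 \<union> (V - K - L)) (complete_on L1 \<union> M)"
      using L1 M x by (intro cubic_on_Un cubic_on_complete_on) (auto simp: L1_def)
    moreover have "L1 \<union> (V - K - L) = V - K1"
      using L x y Suc.prems K' by (auto simp: L1_def K1_def)
    ultimately have H2: "cubic_on (V - K1) (complete_on L1 \<union> M)"
      by simp
    have "reach (complete_on K \<union> H) (complete_on K \<union> (complete_on L \<union> M))"
      using Suc.prems H1 by (intro fix_K)
    moreover have "reach ((complete_on K \<union> complete_on L) \<union> M) ((complete_on K1 \<union> complete_on L1) \<union> M)"
      unfolding K1_def L1_def
    proof (rule reach_Un)
      show "reach (complete_on K \<union> complete_on L)
          (complete_on (insert y (K - {x})) \<union> complete_on (insert x (L - {y})))"
        using Suc.prems L x by (intro reach_swap_K4_sets) auto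
      show "cubic_on (K \<union> L) (complete_on K \<union> complete_on L)"
        using Suc.prems L by (intro cubic_on_Un cubic_on_complete_on) auto
      show "\<forall>f \<in> M. f \<inter> (K \<union> L) = {}"
        using M by (auto simp: cubic_on_def)
    qed
    moreover have "reach (complete_on K1 \<union> (complete_on L1 \<union> M)) (complete_on K' \<union> H')"
    proof (rule Suc.hyps(1))
      \<comment> \<open>As \<open>x\<close> is not in \<open>K'\<close>, giving it up costs nothing,
        and the distance to \<open>K'\<close> drops by exactly one.\<close>
      have "K' - K = insert y (K' - K1)" "y \<notin> K' - K1"
        using x y by (auto simp: K1_def)
      then show "n = card (K' - K1)"
        using Suc.hyps(2) f by simp
    qed (use K1 H2 in auto)
    ultimately show ?case
      by (simp add: Un_assoc)
  }
qed

text \<open>Both graphs first move to one with a K4 component, and \<open>reach_any_K4\<close>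
  connects these. Its hypothesis on graphs outside a four-set is the induction hypothesis, since
  \<open>4\<close> still divides the number of remaining vertices.\<close>

lemma reach_cubic_on:
  assumes "finite V" "4 dvd card V" "cubic_on V E" "cubic_on V E'"
  shows "reach E E'"
  using assms
proof (induction "card V" arbitrary: V E E' rule: less_induct)
  case less
  obtain k where "card V = 4 * k"
    using less.prems(2) by (rule dvdE)
  then consider "card V = 0" | "card V = 4" | "card V \<ge> 8"
    by (cases "k = 0"; cases "k = 1") auto
  then show ?case
  proof cases
    case 1
    then have "V = {}"
      using less.prems by simp
    then have "E = {}" "E' = {}"
      using less.prems by (auto simp: cubic_on_def)
    then show ?thesis by simp
  next
    case 2
    then have "E = E'"
      using less.prems cubic_on_4 by blast
    then show ?thesis by simp
  next
    case 3
    have split: "\<exists>K H. K \<subseteq> V \<and> card K = 4 \<and> cubic_on (V - K) H \<and> reach E (complete_on K \<union> H)"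
      if E: "cubic_on V E" for E
    proof -
      obtain E1 K where E1: "reach E E1" "card K = 4" "complete_on K \<subseteq> E1"
        using cubic_on_reaches_K4[OF E 3] by (auto simp: reaches_K4_def has_K4_def)
      then obtain H where "K \<subseteq> V" "cubic_on (V - K) H" "E1 = complete_on K \<union> H"
        using K4_split[OF cubic_on_reach[OF E1(1) E]] by metis
      with E1 show ?thesis by blast
    qed
    obtain K H where K: "K \<subseteq> V" "card K = 4" "cubic_on (V - K) H" "reach E (complete_on K \<union> H)"
      using split less.prems by blast
    obtain K' H' where K': "K' \<subseteq> V" "card K' = 4" "cubic_on (V - K') H'" "reach E' (complete_on K' \<union> H')"
      using split less.prems by blast
    have "reach (complete_on K \<union> H) (complete_on K' \<union> H')"
    proof (rule reach_any_K4[OF less.prems(1) 3 less.prems(2) _ K(1-3) K'(1-3)])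
      fix J G G' assume J: "J \<subseteq> V" "card J = 4" "cubic_on (V - J) G" "cubic_on (V - J) G'"
      have c: "card (V - J) = card V - 4"
        using J less.prems by (simp add: card_Diff_subset finite_subset)
      show "reach G G'"
      proof (rule less.hyps)
        show "card (V - J) < card V"
          using c 3 by simp
        show "4 dvd card (V - J)"
          unfolding c using less.prems by (intro dvd_diff_nat) auto
      qed (use J less.prems in auto)
    qed
    \<comment> \<open>The path from \<open>E'\<close> to its K4 is run backwards.\<close>
    with K(4) reach_sym[OF K'(4)] less.prems show ?thesis
      by (meson rtranclp_trans)
  qed
qed

section \<open>Connectedness of the move graph\<close>

text \<open>Connectedness of a digraph means strong connectedness of its symmetric closure, where a
  walk has to stay inside the vertex set. It does so because moves preserve cubicity.\<close>

lemma reach_imp_reachable: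
  assumes "reach E E'" "E \<in> cubic_graphs n"
  shows "E \<rightarrow>\<^sup>*\<^bsub>with_proj (mk_symmetric (with_proj (move_graph n)))\<^esub> E'"
  using assms
proof (induction rule: rtranclp_induct)
  case base
  then show ?case
    by (simp add: reachable_def move_graph_def)
next
  case (step F G)
  have "F \<in> cubic_graphs n"
    using cubic_on_reach[OF step.hyps(1)] step.prems by (simp add: cubic_graphs_iff)
  moreover from this have "G \<in> cubic_graphs n"
    using cubic_on_triangle_move[OF _ step.hyps(2)] by (simp add: cubic_graphs_iff)
  ultimately have "(F, G) \<in> parcs (mk_symmetric (with_proj (move_graph n)))"
    and "G \<in> pverts (mk_symmetric (with_proj (move_graph n)))"
    using step.hyps(2) by (auto simp: parcs_mk_symmetric move_graph_def)
  with step.IH[OF step.prems] show ?case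
    unfolding reachable_def with_proj_simps by (rule rtrancl_on_into_rtrancl_on)
qed

theorem theorem9:
  fixes n :: nat
  assumes "[n = 0] (mod 4)"
  shows "Digraph_Component.connected (with_proj (move_graph n))"
proof -
  have n: "4 dvd card {1..n}"
    using assms by (simp add: cong_0_iff)
  have "reach E E'" if "E \<in> cubic_graphs n" "E' \<in> cubic_graphs n" for E E'
    using reach_cubic_on[OF _ n] that by (simp add: cubic_graphs_iff)
  \<comment> \<open>\<open>strongly_connected\<close> includes the existence of a vertex; for
    \<open>n = 0\<close> it is the empty edge set.\<close>
  moreover have "cubic_graphs n \<noteq> {}"
    using ex_cubic_on[OF _ n] by (auto simp: cubic_graphs_iff)
  moreover have "verts (with_proj (mk_symmetric (with_proj (move_graph n)))) = cubic_graphs n"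
    by (simp add: move_graph_def)
  ultimately show ?thesis
    unfolding Digraph_Component.connected_def strongly_connected_def
    using reach_imp_reachable by simp
qed

end
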